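(* Let $\theta\in\mathbb{R}\setminus\mathbb{Q}$, let $(m,n)\in\mathbb{Z}^2$, and let $w=\lambda U^mV^n$ with $\lambda\in\mathbb{C}$, $|\lambda|=1$. Suppose $\phi:C(\operatorname{SU}(2,\mathbb{C}))\to A_\theta$ is a coercive map which is a solution of the Euler-Lagrange equations (stated in the context). Then $\operatorname{Ad}w\circ\phi$ is a solution of the Euler-Lagrange equations.
   Context: For irrational $\theta$, $A_\theta$ is the universal $C^*$-algebra generated by two unitaries $U,V$ with $UV=e^{2\pi i\theta}VU$; $\tau$ is its canonical tracial state, and $A_\theta^\infty$ is the smooth dense subalgebra (elements $\sum a_{m,n}U^mV^n$ with rapidly decreasing coefficients). $\delta_1,\delta_2$ are the $*$-derivations of $A_\theta^\infty$ determined by $\delta_1(U)=2\pi iU$, $\delta_1(V)=0$, $\delta_2(U)=0$, $\delta_2(V)=2\pi iV$. $\operatorname{Ad}w$ is the inner automorphism $a\mapsto waw^*$. $C(\operatorname{SU}(2,\mathbb{C}))$ is the commutative $C^*$-algebra generated by the coordinate functions $\alpha,\gamma$ sending $\begin{pmatrix}a&-\bar b\\ b&\bar a\end{pmatrix}$ to $a$ and $b$ respectively, i.e. the universal unital $C^*$-algebra generated by commuting normal elements $\alpha,\gamma$ with $\alpha^*\alpha+\gamma^*\gamma=1$. A unital $*$-homomorphism $\phi:C(\operatorname{SU}(2,\mathbb{C}))\to A_\theta$ is coercive if $\phi(\alpha)=\mu u$ and $\phi(\gamma)=\nu v$ for some $\mu,\nu\in\mathbb{C}\setminus\{0\}$ and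 unitaries $u,v\in A_\theta$ (then $|\mu|^2+|\nu|^2=1$); $u,v$ are taken in $A_\theta^\infty$. A coercive $\phi$ is a solution of the Euler-Lagrange equations if for all self-adjoint $A,B\in A_\theta$ satisfying $$\phi(\alpha)A\phi(\gamma)-\phi(\gamma)\phi(\alpha)A=\phi(\gamma)B\phi(\alpha)-\phi(\alpha)\phi(\gamma)B,$$ $$\phi(\alpha)A\phi(\gamma^* )-\phi(\gamma^* )\phi(\alpha)A=\phi(\alpha)B\phi(\gamma^* )-B\phi(\gamma^* )\phi(\alpha),$$ one has $$\sum_{j=1}^2\tau\big(A\,\delta_j[\phi(\alpha)^*\delta_j(\phi(\alpha))]\big)+\sum_{j=1}^2\tau\big(B\,\delta_j[\phi(\gamma)^*\delta_j(\phi(\gamma))]\big)=0.$$ *)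

theory Defs
  imports "HOL-Analysis.Analysis"
begin

section \<open>Unital C*-algebras\<close>

class cstar_algebra = real_normed_algebra_1 + banach +
  fixes scaleC :: "complex \<Rightarrow> 'a \<Rightarrow> 'a" (infixr "*\<^sub>C" 75)
    and star :: "'a \<Rightarrow> 'a"
  assumes scaleC_add_right: "c *\<^sub>C (x + y) = c *\<^sub>C x + c *\<^sub>C y"
    and scaleC_add_left: "(c + d) *\<^sub>C x = c *\<^sub>C x + d *\<^sub>C x"
    and scaleC_scaleC: "c *\<^sub>C d *\<^sub>C x = (c * d) *\<^sub>C x"
    and scaleR_eq_scaleC: "r *\<^sub>R x = complex_of_real r *\<^sub>C x"
    and mult_scaleC_left: "(c *\<^sub>C x) * y = c *\<^sub>C (x * y)"
    and mult_scaleC_right: "x * (c *\<^sub>C y) = c *\<^sub>C (x * y)"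
    and norm_scaleC: "norm (c *\<^sub>C x) = cmod c * norm x"
    and star_star: "star (star x) = x"
    and star_add: "star (x + y) = star x + star y"
    and star_scaleC: "star (c *\<^sub>C x) = cnj c *\<^sub>C star x"
    and star_mult: "star (x * y) = star y * star x"
    and cstar_identity: "norm (star x * x) = (norm x)\<^sup>2"

definition star_hom :: "('a::cstar_algebra \<Rightarrow> 'b::cstar_algebra) \<Rightarrow> bool" where
  "star_hom f \<longleftrightarrow>
     (\<forall>x y. f (x + y) = f x + f y) \<and> (\<forall>c x. f (c *\<^sub>C x) = c *\<^sub>C f x) \<and>
     (\<forall>x y. f (x * y) = f x * f y) \<and> (\<forall>x. f (star x) = star (f x)) \<and> f 1 = 1"

definition self_adjoint :: "'a::cstar_algebra \<Rightarrow> bool" where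
  "self_adjoint x \<longleftrightarrow> star x = x"

definition unitary :: "'a::cstar_algebra \<Rightarrow> bool" where
  "unitary u \<longleftrightarrow> star u * u = 1 \<and> u * star u = 1"

definition Ad :: "'a::cstar_algebra \<Rightarrow> 'a \<Rightarrow> 'a" where
  "Ad w a = w * a * star w"

definition upow :: "'a::cstar_algebra \<Rightarrow> int \<Rightarrow> 'a" where
  "upow u k = (if 0 \<le> k then u ^ nat k else star u ^ nat (- k))" \<comment> \<open>for unitary \<open>u\<close>\<close>

definition star_subalgebra :: "'a::cstar_algebra set \<Rightarrow> bool" where
  "star_subalgebra S \<longleftrightarrow> 1 \<in> S \<and> (\<forall>x\<in>S. \<forall>y\<in>S. x + y \<in> S) \<and> (\<forall>x\<in>S. \<forall>y\<in>S. x * y \<in> S) \<and>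
     (\<forall>c. \<forall>x\<in>S. c *\<^sub>C x \<in> S) \<and> (\<forall>x\<in>S. star x \<in> S)"

definition cstar_generated :: "'a::cstar_algebra set \<Rightarrow> 'a set" where
  "cstar_generated G = \<Inter>{S. star_subalgebra S \<and> closed S \<and> G \<subseteq> S}"

lemma scaleC_one: "1 *\<^sub>C x = x"
  using scaleR_eq_scaleC[of 1 x] by simp

lemma scaleC_zero: "0 *\<^sub>C x = 0"
  using scaleR_eq_scaleC[of 0 x] by simp

lemma norm_star: "norm (star x) = norm x" for x :: "'a::cstar_algebra"
proof -
  have le: "norm y \<le> norm (star y)" for y :: 'a
  proof (cases "y = 0")
    case False
    have "norm y * norm y \<le> norm (star y) * norm y"
      using norm_mult_ineq[of "star y" y] by (simp add: cstar_identity power2_eq_square)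
    then show ?thesis
      using False by simp
  qed simp
  show ?thesis
    using le[of x] le[of "star x"] by (simp add: star_star)
qed

lemma bounded_linear_scaleC: "bounded_linear (\<lambda>x. c *\<^sub>C x)"
  by (rule bounded_linear_intro[of _ "cmod c"])
    (simp_all add: scaleC_add_right scaleR_eq_scaleC scaleC_scaleC norm_scaleC mult.commute)

lemma bounded_linear_star: "bounded_linear (star :: 'a::cstar_algebra \<Rightarrow> 'a)"
  by (rule bounded_linear_intro[of _ 1])
    (simp_all add: star_add scaleR_eq_scaleC star_scaleC norm_star)

instantiation complex :: cstar_algebra
begin

definition scaleC_complex :: "complex \<Rightarrow> complex \<Rightarrow> complex" where
  "scaleC_complex c x = c * x"

definition star_complex :: "complex \<Rightarrow> complex" where
  "star_complex x = cnj x"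

instance
  by standard
    (simp_all add: scaleC_complex_def star_complex_def algebra_simps scaleR_conv_of_real
      norm_mult power2_eq_square)

end


section \<open>C*-algebras carried by a set\<close>

text \<open>
  A universal property quantifies over all C*-algebras, which the type class cannot
  express inside a formula. As targets we therefore also consider unital C*-algebras
  whose underlying set is an arbitrary subset of a type.
\<close>

record 'b cstar_data =
  carr :: "'b set"
  add :: "'b \<Rightarrow> 'b \<Rightarrow> 'b" (infixl "\<oplus>\<index>" 65)
  mul :: "'b \<Rightarrow> 'b \<Rightarrow> 'b" (infixl "\<otimes>\<index>" 70)
  nul :: 'b ("\<zero>\<index>")
  one :: 'b ("\<one>\<index>")
  scal :: "complex \<Rightarrow> 'b \<Rightarrow> 'b" (infixr "\<odot>\<index>" 75)
  adj :: "'b \<Rightarrow> 'b"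
  nrm :: "'b \<Rightarrow> real"

locale cstar_structure =
  fixes B :: "'b cstar_data" (structure)
  assumes add_closed: "\<lbrakk>x \<in> carr B; y \<in> carr B\<rbrakk> \<Longrightarrow> x \<oplus> y \<in> carr B"
    and mul_closed: "\<lbrakk>x \<in> carr B; y \<in> carr B\<rbrakk> \<Longrightarrow> x \<otimes> y \<in> carr B"
    and nul_closed: "\<zero> \<in> carr B"
    and one_closed: "\<one> \<in> carr B"
    and scal_closed: "x \<in> carr B \<Longrightarrow> c \<odot> x \<in> carr B"
    and adj_closed: "x \<in> carr B \<Longrightarrow> adj B x \<in> carr B"
    and add_assoc: "\<lbrakk>x \<in> carr B; y \<in> carr B; z \<in> carr B\<rbrakk> \<Longrightarrow> (x \<oplus> y) \<oplus> z = x \<oplus> (y \<oplus> z)"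
    and add_comm: "\<lbrakk>x \<in> carr B; y \<in> carr B\<rbrakk> \<Longrightarrow> x \<oplus> y = y \<oplus> x"
    and add_nul: "x \<in> carr B \<Longrightarrow> x \<oplus> \<zero> = x"
    and add_inverse: "x \<in> carr B \<Longrightarrow> x \<oplus> (-1) \<odot> x = \<zero>"
    and scal_one: "x \<in> carr B \<Longrightarrow> 1 \<odot> x = x"
    and scal_scal: "x \<in> carr B \<Longrightarrow> c \<odot> d \<odot> x = (c * d) \<odot> x"
    and scal_add_left: "x \<in> carr B \<Longrightarrow> (c + d) \<odot> x = c \<odot> x \<oplus> d \<odot> x"
    and scal_add_right: "\<lbrakk>x \<in> carr B; y \<in> carr B\<rbrakk> \<Longrightarrow> c \<odot> (x \<oplus> y) = c \<odot> x \<oplus> c \<odot> y"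
    and mul_assoc: "\<lbrakk>x \<in> carr B; y \<in> carr B; z \<in> carr B\<rbrakk> \<Longrightarrow> (x \<otimes> y) \<otimes> z = x \<otimes> (y \<otimes> z)"
    and one_mul: "x \<in> carr B \<Longrightarrow> \<one> \<otimes> x = x"
    and mul_one: "x \<in> carr B \<Longrightarrow> x \<otimes> \<one> = x"
    and add_mul: "\<lbrakk>x \<in> carr B; y \<in> carr B; z \<in> carr B\<rbrakk> \<Longrightarrow> (x \<oplus> y) \<otimes> z = x \<otimes> z \<oplus> y \<otimes> z"
    and mul_add: "\<lbrakk>x \<in> carr B; y \<in> carr B; z \<in> carr B\<rbrakk> \<Longrightarrow> x \<otimes> (y \<oplus> z) = x \<otimes> y \<oplus> x \<otimes> z"
    and scal_mul: "\<lbrakk>x \<in> carr B; y \<in> carr B\<rbrakk> \<Longrightarrow> (c \<odot> x) \<otimes> y = c \<odot> (x \<otimes> y)"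
    and mul_scal: "\<lbrakk>x \<in> carr B; y \<in> carr B\<rbrakk> \<Longrightarrow> x \<otimes> (c \<odot> y) = c \<odot> (x \<otimes> y)"
    and adj_adj: "x \<in> carr B \<Longrightarrow> adj B (adj B x) = x"
    and adj_add: "\<lbrakk>x \<in> carr B; y \<in> carr B\<rbrakk> \<Longrightarrow> adj B (x \<oplus> y) = adj B x \<oplus> adj B y"
    and adj_scal: "x \<in> carr B \<Longrightarrow> adj B (c \<odot> x) = cnj c \<odot> adj B x"
    and adj_mul: "\<lbrakk>x \<in> carr B; y \<in> carr B\<rbrakk> \<Longrightarrow> adj B (x \<otimes> y) = adj B y \<otimes> adj B x"
    and nrm_ge_0: "x \<in> carr B \<Longrightarrow> 0 \<le> nrm B x"
    and nrm_eq_0: "x \<in> carr B \<Longrightarrow> nrm B x = 0 \<longleftrightarrow> x = \<zero>"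
    and nrm_scal: "x \<in> carr B \<Longrightarrow> nrm B (c \<odot> x) = cmod c * nrm B x"
    and nrm_add: "\<lbrakk>x \<in> carr B; y \<in> carr B\<rbrakk> \<Longrightarrow> nrm B (x \<oplus> y) \<le> nrm B x + nrm B y"
    and nrm_mul: "\<lbrakk>x \<in> carr B; y \<in> carr B\<rbrakk> \<Longrightarrow> nrm B (x \<otimes> y) \<le> nrm B x * nrm B y"
    and nrm_cstar: "x \<in> carr B \<Longrightarrow> nrm B (adj B x \<otimes> x) = (nrm B x)\<^sup>2"
    and complete:
      "\<lbrakk>range X \<subseteq> carr B; \<forall>e>0. \<exists>N. \<forall>i\<ge>N. \<forall>j\<ge>N. nrm B (X i \<oplus> (-1) \<odot> X j) < e\<rbrakk>
       \<Longrightarrow> \<exists>x\<in>carr B. (\<lambda>i. nrm B (X i \<oplus> (-1) \<odot> x)) \<longlonglongrightarrow> 0"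

lemma cstar_structure_UNIV:
  "cstar_structure \<lparr>carr = UNIV :: 'a::cstar_algebra set, add = (+), mul = (*), nul = 0, one = 1,
     scal = scaleC, adj = star, nrm = norm\<rparr>"
proof -
  have m1: "(-1) *\<^sub>C x = - x" for x :: 'a
    using scaleR_eq_scaleC[of "-1" x] by simp
  have "\<exists>x. (\<lambda>i. norm (X i - x)) \<longlonglongrightarrow> 0"
    if X: "\<forall>e>0. \<exists>N::nat. \<forall>i\<ge>N. \<forall>j\<ge>N. norm (X i - X j) < e" for X :: "nat \<Rightarrow> 'a"
  proof -
    have "Cauchy X"
      using X by (simp add: Cauchy_iff)
    then obtain x where "X \<longlonglongrightarrow> x"
      using Cauchy_convergent convergent_def by blast
    then show ?thesis
      using LIM_zero tendsto_norm_zero by blast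
  qed
  then show ?thesis
    by unfold_locales
      (auto simp: m1 scaleC_one scaleC_scaleC scaleC_add_left scaleC_add_right mult_scaleC_left
        mult_scaleC_right algebra_simps star_star star_add star_scaleC star_mult norm_scaleC
        norm_triangle_ineq norm_mult_ineq cstar_identity)
qed

definition star_hom_into :: "'b cstar_data \<Rightarrow> ('a::cstar_algebra \<Rightarrow> 'b) \<Rightarrow> bool" where
  "star_hom_into B f \<longleftrightarrow> range f \<subseteq> carr B \<and>
     (\<forall>x y. f (x + y) = f x \<oplus>\<^bsub>B\<^esub> f y) \<and> (\<forall>c x. f (c *\<^sub>C x) = c \<odot>\<^bsub>B\<^esub> f x) \<and>
     (\<forall>x y. f (x * y) = f x \<otimes>\<^bsub>B\<^esub> f y) \<and> (\<forall>x. f (star x) = adj B (f x)) \<and> f 1 = \<one>\<^bsub>B\<^esub>"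

definition unitary_in :: "'b cstar_data \<Rightarrow> 'b \<Rightarrow> bool" where
  "unitary_in B u \<longleftrightarrow>
     u \<in> carr B \<and> adj B u \<otimes>\<^bsub>B\<^esub> u = \<one>\<^bsub>B\<^esub> \<and> u \<otimes>\<^bsub>B\<^esub> adj B u = \<one>\<^bsub>B\<^esub>"


section \<open>The rotation algebra\<close>

text \<open>
  A *-homomorphism out of the rotation algebra takes its values in the C*-subalgebra generated
  by the images of \<open>U\<close> and \<open>V\<close>. Such a subalgebra has at most continuum many elements, so up
  to isomorphism its carrier is a set of real numbers. Hence quantifying over the C*-algebras
  carried by subsets of \<^typ>\<open>real\<close> captures the universal property with respect to all
  unital C*-algebras.
\<close>

definition rotation_algebra :: "real \<Rightarrow> 'a::cstar_algebra \<Rightarrow> 'a \<Rightarrow> bool" where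
  "rotation_algebra \<theta> U V \<longleftrightarrow>
     unitary U \<and> unitary V \<and> U * V = exp (2 * pi * \<i> * \<theta>) *\<^sub>C (V * U) \<and>
     cstar_generated {U, V} = UNIV \<and>
     (\<forall>(B :: real cstar_data) u v.
        cstar_structure B \<and> unitary_in B u \<and> unitary_in B v \<and>
        u \<otimes>\<^bsub>B\<^esub> v = exp (2 * pi * \<i> * \<theta>) \<odot>\<^bsub>B\<^esub> (v \<otimes>\<^bsub>B\<^esub> u) \<longrightarrow>
        (\<exists>!f. star_hom_into B f \<and> f U = u \<and> f V = v))"

definition monomial :: "'a::cstar_algebra \<Rightarrow> 'a \<Rightarrow> int \<times> int \<Rightarrow> 'a" where
  "monomial U V = (\<lambda>(m, n). upow U m * upow V n)"

definition canonical_trace :: "'a::cstar_algebra \<Rightarrow> 'a \<Rightarrow> ('a \<Rightarrow> complex) \<Rightarrow> bool" where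
  "canonical_trace U V \<tau> \<longleftrightarrow>
     (\<forall>x y. \<tau> (x + y) = \<tau> x + \<tau> y) \<and> (\<forall>c x. \<tau> (c *\<^sub>C x) = c * \<tau> x) \<and>
     (\<forall>x. \<tau> (star x * x) \<in> \<real> \<and> 0 \<le> Re (\<tau> (star x * x))) \<and> \<tau> 1 = 1 \<and>
     (\<forall>x y. \<tau> (x * y) = \<tau> (y * x)) \<and>
     (\<forall>p. p \<noteq> (0, 0) \<longrightarrow> \<tau> (monomial U V p) = 0)"

definition rapidly_decreasing :: "(int \<times> int \<Rightarrow> complex) \<Rightarrow> bool" where
  "rapidly_decreasing a \<longleftrightarrow>
     (\<forall>k. \<exists>C. \<forall>m n. (1 + \<bar>real_of_int m\<bar> + \<bar>real_of_int n\<bar>) ^ k * cmod (a (m, n)) \<le> C)"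

definition smooth :: "'a::cstar_algebra \<Rightarrow> 'a \<Rightarrow> 'a set" where
  "smooth U V =
     {x. \<exists>a. rapidly_decreasing a \<and> ((\<lambda>p. a p *\<^sub>C monomial U V p) has_sum x) UNIV}"

text \<open>
  The values at \<open>U\<close> and \<open>V\<close> determine a *-derivation of the smooth subalgebra by continuity
  in its Frechet topology, in which the series \<open>\<Sum>a\<^sub>p W\<^sub>p\<close> (\<open>W\<^sub>p\<close> the monomials, \<open>a\<close> rapidly
  decreasing) converges. The last clause is this continuity: the derivation may be applied
  term by term. Outside the smooth subalgebra the values of \<open>d\<close> are irrelevant.
\<close>

definition smooth_star_derivation ::
    "'a::cstar_algebra \<Rightarrow> 'a \<Rightarrow> ('a \<Rightarrow> 'a) \<Rightarrow> bool" where
  "smooth_star_derivation U V d \<longleftrightarrow>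
     (\<forall>x\<in>smooth U V. d x \<in> smooth U V) \<and>
     (\<forall>x\<in>smooth U V. \<forall>y\<in>smooth U V. d (x + y) = d x + d y) \<and>
     (\<forall>c. \<forall>x\<in>smooth U V. d (c *\<^sub>C x) = c *\<^sub>C d x) \<and>
     (\<forall>x\<in>smooth U V. \<forall>y\<in>smooth U V. d (x * y) = d x * y + x * d y) \<and>
     (\<forall>x\<in>smooth U V. d (star x) = star (d x)) \<and>
     (\<forall>a x. rapidly_decreasing a \<and> ((\<lambda>p. a p *\<^sub>C monomial U V p) has_sum x) UNIV \<longrightarrow>
        ((\<lambda>p. a p *\<^sub>C d (monomial U V p)) has_sum d x) UNIV)"

definition canonical_derivations ::
    "'a::cstar_algebra \<Rightarrow> 'a \<Rightarrow> (nat \<Rightarrow> 'a \<Rightarrow> 'a) \<Rightarrow> bool" where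
  "canonical_derivations U V \<delta> \<longleftrightarrow>
     smooth_star_derivation U V (\<delta> 1) \<and> smooth_star_derivation U V (\<delta> 2) \<and>
     \<delta> 1 U = (2 * pi * \<i>) *\<^sub>C U \<and> \<delta> 1 V = 0 \<and>
     \<delta> 2 U = 0 \<and> \<delta> 2 V = (2 * pi * \<i>) *\<^sub>C V"


lemma monomial_smooth: "monomial U V q \<in> smooth U V"
proof -
  define a :: "int \<times> int \<Rightarrow> complex" where "a = (\<lambda>p. if p = q then 1 else 0)"
  obtain m0 n0 where q: "q = (m0, n0)"
    by fastforce
  have "rapidly_decreasing a"
    unfolding rapidly_decreasing_def
  proof
    fix k
    show "\<exists>C. \<forall>m n. (1 + \<bar>real_of_int m\<bar> + \<bar>real_of_int n\<bar>) ^ k * cmod (a (m, n)) \<le> C"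
      by (rule exI[of _ "(1 + \<bar>real_of_int m0\<bar> + \<bar>real_of_int n0\<bar>) ^ k"]) (auto simp: a_def q)
  qed
  moreover have "((\<lambda>p. a p *\<^sub>C monomial U V p) has_sum monomial U V q) UNIV"
    by (rule has_sum_finiteI[of "{q}", THEN has_sum_cong_neutral[THEN iffD1, rotated -1]])
      (auto simp: a_def scaleC_zero scaleC_one)
  ultimately show ?thesis
    unfolding smooth_def by blast
qed

lemma smooth_star_derivation_monomial:
  fixes U V :: "'a::cstar_algebra"
  assumes d: "smooth_star_derivation U V d"
    and dU: "d U = (complex_of_real r * \<i>) *\<^sub>C U" and dV: "d V = (complex_of_real s * \<i>) *\<^sub>C V"
  shows "d (monomial U V (m, n)) = ((r * m + s * n) * \<i>) *\<^sub>C monomial U V (m, n)"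
proof -
  have D: "d (x * y) = d x * y + x * d y" "d (star x) = star (d x)"
    if "x \<in> smooth U V" "y \<in> smooth U V" for x y
    using d that by (auto simp: smooth_star_derivation_def)
  have uU: "upow U k \<in> smooth U V" for k
    using monomial_smooth[of U V "(k, 0)"] by (simp add: monomial_def upow_def)
  have uV: "upow V k \<in> smooth U V" for k
    using monomial_smooth[of U V "(0, k)"] by (simp add: monomial_def upow_def)
  have one: "1 \<in> smooth U V"
    using uU[of 0] by (simp add: upow_def)
  have d1: "d 1 = 0"
    using D(1)[OF one one] by simp
  have pow: "d (x ^ k) = (of_nat k * c) *\<^sub>C x ^ k"
    if x: "\<And>k. x ^ k \<in> smooth U V" and dx: "d x = c *\<^sub>C x" for x c k
  proof (induction k)
    case 0
    then show ?case
      by (simp add: d1 scaleC_zero)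
  next
    case (Suc k)
    have "d (x ^ Suc k) = d x * x ^ k + x * d (x ^ k)"
      using D(1)[of x "x ^ k"] x[of 1] x[of k] by simp
    also have "\<dots> = (of_nat (Suc k) * c) *\<^sub>C x ^ Suc k"
      by (simp add: Suc.IH dx mult_scaleC_left mult_scaleC_right distrib_right scaleC_add_left)
    finally show ?case .
  qed
  have upow: "d (upow u k) = (r * of_int k * \<i>) *\<^sub>C upow u k"
    if u: "\<And>k. upow u k \<in> smooth U V" and du: "d u = (complex_of_real r * \<i>) *\<^sub>C u" for u r k
  proof (cases "0 \<le> k")
    case True
    have "u ^ i \<in> smooth U V" for i
      using u[of "int i"] by (simp add: upow_def)
    from pow[OF this du, of "nat k"] True show ?thesis
      by (simp add: upow_def algebra_simps)
  next
    case False
    have us: "u \<in> smooth U V"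
      using u[of 1] by (simp add: upow_def)
    have sm: "star u ^ i \<in> smooth U V" for i
      using u[of "- int i"] by (cases "i = 0") (simp_all add: upow_def)
    have "d (star u) = (- (complex_of_real r * \<i>)) *\<^sub>C star u"
      using D(2)[OF us us] by (simp add: du star_scaleC)
    from pow[OF sm this, of "nat (- k)"] False show ?thesis
      by (simp add: upow_def algebra_simps)
  qed
  show ?thesis
    using D(1)[OF uU uV] upow[OF uU dU, of m] upow[OF uV dV, of n]
    by (simp add: monomial_def mult_scaleC_left mult_scaleC_right scaleC_add_left distrib_right)
qed

text \<open>
  So the canonical derivations are \<open>\<delta>\<^sub>1 (\<Sum>a\<^sub>m\<^sub>n U\<^sup>m V\<^sup>n) = \<Sum>2\<pi>\<i>m a\<^sub>m\<^sub>n U\<^sup>m V\<^sup>n\<close> and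
  \<open>\<delta>\<^sub>2 (\<Sum>a\<^sub>m\<^sub>n U\<^sup>m V\<^sup>n) = \<Sum>2\<pi>\<i>n a\<^sub>m\<^sub>n U\<^sup>m V\<^sup>n\<close>.
\<close>

lemma canonical_derivations_series:
  fixes U V :: "'a::cstar_algebra"
  assumes \<delta>: "canonical_derivations U V \<delta>"
    and a: "rapidly_decreasing a" "((\<lambda>p. a p *\<^sub>C monomial U V p) has_sum x) UNIV"
  shows "((\<lambda>(m, n). (2 * pi * \<i> * m * a (m, n)) *\<^sub>C monomial U V (m, n)) has_sum \<delta> 1 x) UNIV"
    and "((\<lambda>(m, n). (2 * pi * \<i> * n * a (m, n)) *\<^sub>C monomial U V (m, n)) has_sum \<delta> 2 x) UNIV"
proof -
  have d: "smooth_star_derivation U V (\<delta> 1)" "smooth_star_derivation U V (\<delta> 2)"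
    and v: "\<delta> 1 U = (complex_of_real (2 * pi) * \<i>) *\<^sub>C U" "\<delta> 1 V = (complex_of_real 0 * \<i>) *\<^sub>C V"
      "\<delta> 2 U = (complex_of_real 0 * \<i>) *\<^sub>C U" "\<delta> 2 V = (complex_of_real (2 * pi) * \<i>) *\<^sub>C V"
    using \<delta> by (simp_all add: canonical_derivations_def scaleC_zero)
  have *: "((\<lambda>p. a p *\<^sub>C \<delta> j (monomial U V p)) has_sum \<delta> j x) UNIV" if "j = 1 \<or> j = 2" for j
    using that d a unfolding smooth_star_derivation_def by blast
  show "((\<lambda>(m, n). (2 * pi * \<i> * m * a (m, n)) *\<^sub>C monomial U V (m, n)) has_sum \<delta> 1 x) UNIV"
    using *[of 1]
    by (rule has_sum_cong[THEN iffD1, rotated])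
      (auto simp: smooth_star_derivation_monomial[OF d(1) v(1,2)] scaleC_scaleC mult_ac
        simp del: One_nat_def)
  show "((\<lambda>(m, n). (2 * pi * \<i> * n * a (m, n)) *\<^sub>C monomial U V (m, n)) has_sum \<delta> 2 x) UNIV"
    using *[of 2]
    by (rule has_sum_cong[THEN iffD1, rotated])
      (auto simp: smooth_star_derivation_monomial[OF d(2) v(3,4)] scaleC_scaleC mult_ac)
qed


section \<open>The algebra of continuous functions on SU(2)\<close>

definition ctranspose :: "complex^2^2 \<Rightarrow> complex^2^2" where
  "ctranspose M = (\<chi> i j. cnj (M $ j $ i))"

definition SU2 :: "(complex^2^2) set" where
  "SU2 = {M. ctranspose M ** M = mat 1 \<and> det M = 1}"

lemma SU2_eq:
  "SU2 = {vector [vector [a, - cnj b], vector [b, cnj a]] | a b. (cmod a)\<^sup>2 + (cmod b)\<^sup>2 = 1}"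
proof (intro equalityI subsetI)
  fix M assume "M \<in> SU2"
  then have U: "ctranspose M ** M = mat 1" and D: "det M = 1"
    by (auto simp: SU2_def)
  define a b c d where abcd: "a = M $ 1 $ 1" "b = M $ 2 $ 1" "c = M $ 1 $ 2" "d = M $ 2 $ 2"
  have e: "(ctranspose M ** M) $ i $ j = mat 1 $ i $ j" for i j
    using U by simp
  have e11: "cnj a * a + cnj b * b = 1" and e12: "cnj a * c + cnj b * d = 0"
    using e[of 1 1] e[of 1 2]
    by (simp_all add: matrix_matrix_mult_def ctranspose_def mat_def sum_2 abcd)
  have det: "a * d - c * b = 1"
    using D by (simp add: det_2 abcd)
  have "d = d * (cnj a * a + cnj b * b)"
    using e11 by simp
  also have "\<dots> = cnj a * (a * d - c * b) + b * (cnj a * c + cnj b * d)"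
    by (simp add: algebra_simps)
  finally have d: "d = cnj a"
    by (simp add: det e12)
  have "c = c * (cnj a * a + cnj b * b)"
    using e11 by simp
  also have "\<dots> = a * (cnj a * c + cnj b * d) - cnj b * (a * d - c * b)"
    by (simp add: algebra_simps)
  finally have c: "c = - cnj b"
    by (simp add: det e12)
  have "complex_of_real ((cmod a)\<^sup>2 + (cmod b)\<^sup>2) = 1"
    unfolding of_real_add complex_norm_square using e11 by (simp add: mult.commute)
  then have "(cmod a)\<^sup>2 + (cmod b)\<^sup>2 = 1"
    using of_real_eq_1_iff by blast
  moreover have "M = vector [vector [a, - cnj b], vector [b, cnj a]]"
    by (simp add: vec_eq_iff forall_2 vector_2 abcd(1,2)) (use c d abcd in simp)
  ultimately show "M \<in> {vector [vector [a, - cnj b], vector [b, cnj a]] | a b.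
      (cmod a)\<^sup>2 + (cmod b)\<^sup>2 = 1}"
    by blast
next
  fix M :: "complex^2^2"
  assume "M \<in> {vector [vector [a, - cnj b], vector [b, cnj a]] | a b.
      (cmod a)\<^sup>2 + (cmod b)\<^sup>2 = 1}"
  then obtain a b where M: "M = vector [vector [a, - cnj b], vector [b, cnj a]]"
    and n: "(cmod a)\<^sup>2 + (cmod b)\<^sup>2 = 1"
    by blast
  have "a * cnj a + b * cnj b = complex_of_real ((cmod a)\<^sup>2 + (cmod b)\<^sup>2)"
    by (simp only: of_real_add complex_norm_square)
  then have n': "a * cnj a + b * cnj b = 1"
    by (simp add: n)
  then show "M \<in> SU2"
    by (simp add: SU2_def M vec_eq_iff forall_2 matrix_matrix_mult_def ctranspose_def mat_def
        sum_2 det_2 algebra_simps)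
qed

typedef su2 = SU2
proof
  show "mat 1 \<in> SU2"
    by (simp add: SU2_def ctranspose_def mat_def vec_eq_iff forall_2 matrix_matrix_mult_def sum_2
        det_2)
qed

instantiation su2 :: metric_space
begin

definition dist_su2 :: "su2 \<Rightarrow> su2 \<Rightarrow> real" where
  "dist_su2 x y = dist (Rep_su2 x) (Rep_su2 y)"

definition uniformity_su2 :: "(su2 \<times> su2) filter" where
  "uniformity_su2 = (INF e\<in>{0<..}. principal {(x, y). dist x y < e})"

definition open_su2 :: "su2 set \<Rightarrow> bool" where
  "open_su2 S \<longleftrightarrow> (\<forall>x\<in>S. \<forall>\<^sub>F (x', y) in uniformity. x' = x \<longrightarrow> y \<in> S)"

instance
  by standard
    (auto simp: dist_su2_def uniformity_su2_def open_su2_def Rep_su2_inject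
      intro: dist_triangle2)

end

lemma continuous_on_Rep_su2: "continuous_on S Rep_su2"
  by (auto simp: continuous_on_iff dist_su2_def)

instantiation bcontfun :: (metric_space, cstar_algebra) cstar_algebra
begin

definition one_bcontfun :: "'a \<Rightarrow>\<^sub>C 'b" where
  "one_bcontfun = Bcontfun (\<lambda>_. 1)"

definition times_bcontfun :: "('a \<Rightarrow>\<^sub>C 'b) \<Rightarrow> ('a \<Rightarrow>\<^sub>C 'b) \<Rightarrow> 'a \<Rightarrow>\<^sub>C 'b" where
  "times_bcontfun f g = Bcontfun (\<lambda>x. f x * g x)"

definition scaleC_bcontfun :: "complex \<Rightarrow> ('a \<Rightarrow>\<^sub>C 'b) \<Rightarrow> 'a \<Rightarrow>\<^sub>C 'b" where
  "scaleC_bcontfun c f = Bcontfun (\<lambda>x. c *\<^sub>C f x)"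

definition star_bcontfun :: "('a \<Rightarrow>\<^sub>C 'b) \<Rightarrow> 'a \<Rightarrow>\<^sub>C 'b" where
  "star_bcontfun f = Bcontfun (\<lambda>x. star (f x))"

lemma bcontfun_mem:
  fixes f g :: "'a \<Rightarrow>\<^sub>C 'b"
  shows "(\<lambda>_::'a. 1::'b) \<in> bcontfun" "(\<lambda>x. f x * g x) \<in> bcontfun"
    "(\<lambda>x. c *\<^sub>C f x) \<in> bcontfun" "(\<lambda>x. star (f x)) \<in> bcontfun"
proof -
  show "(\<lambda>_::'a. 1::'b) \<in> bcontfun"
    by (rule const_bcontfun)
  show "(\<lambda>x. f x * g x) \<in> bcontfun"
    by (rule bcontfun_normI[where b = "norm f * norm g"])
      (auto intro!: continuous_intros order_trans[OF norm_mult_ineq] mult_mono norm_bounded)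
  show "(\<lambda>x. c *\<^sub>C f x) \<in> bcontfun"
    by (rule bcontfun_normI[where b = "cmod c * norm f"])
      (auto intro!: bounded_linear.continuous_on[OF bounded_linear_scaleC] mult_left_mono
        norm_bounded simp: norm_scaleC)
  show "(\<lambda>x. star (f x)) \<in> bcontfun"
    by (rule bcontfun_normI[where b = "norm f"])
      (auto intro!: bounded_linear.continuous_on[OF bounded_linear_star] norm_bounded
        simp: norm_star)
qed

lemma apply_bcontfun_simps:
  fixes f g :: "'a \<Rightarrow>\<^sub>C 'b"
  shows "(1 :: 'a \<Rightarrow>\<^sub>C 'b) x = 1" "(f * g) x = f x * g x"
    "(c *\<^sub>C f) x = c *\<^sub>C f x" "(star f) x = star (f x)"
  by (simp_all add: one_bcontfun_def times_bcontfun_def scaleC_bcontfun_def star_bcontfun_def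
      Bcontfun_inverse bcontfun_mem)

instance
proof
  fix f g h :: "'a \<Rightarrow>\<^sub>C 'b" and c d :: complex and r :: real
  show "f * g * h = f * (g * h)" "(f + g) * h = f * h + g * h" "f * (g + h) = f * g + f * h"
    "1 * f = f" "f * 1 = f" "r *\<^sub>R f * g = r *\<^sub>R (f * g)" "f * r *\<^sub>R g = r *\<^sub>R (f * g)"
    "c *\<^sub>C (f + g) = c *\<^sub>C f + c *\<^sub>C g" "(c + d) *\<^sub>C f = c *\<^sub>C f + d *\<^sub>C f"
    "c *\<^sub>C d *\<^sub>C f = (c * d) *\<^sub>C f" "r *\<^sub>R f = complex_of_real r *\<^sub>C f"
    "(c *\<^sub>C f) * g = c *\<^sub>C (f * g)" "f * (c *\<^sub>C g) = c *\<^sub>C (f * g)"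
    "star (star f) = f" "star (f + g) = star f + star g" "star (c *\<^sub>C f) = cnj c *\<^sub>C star f"
    "star (f * g) = star g * star f"
    by (rule bcontfun_eqI; simp add: apply_bcontfun_simps algebra_simps scaleC_add_right
        scaleC_add_left scaleC_scaleC mult_scaleC_left mult_scaleC_right star_star star_add
        star_scaleC star_mult scaleR_eq_scaleC)+
  show "(0 :: 'a \<Rightarrow>\<^sub>C 'b) \<noteq> 1"
  proof
    assume "(0 :: 'a \<Rightarrow>\<^sub>C 'b) = 1"
    then have "(0 :: 'a \<Rightarrow>\<^sub>C 'b) undefined = (1 :: 'a \<Rightarrow>\<^sub>C 'b) undefined"
      by simp
    then show False
      by (simp add: apply_bcontfun_simps)
  qed
  show mult: "norm (f * g) \<le> norm f * norm g"
    by (rule norm_bound)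
      (auto simp: apply_bcontfun_simps intro!: order_trans[OF norm_mult_ineq] mult_mono norm_bounded)
  show "norm (1 :: 'a \<Rightarrow>\<^sub>C 'b) = 1"
    using norm_bounded[of "1 :: 'a \<Rightarrow>\<^sub>C 'b" undefined] norm_bound[of "1 :: 'a \<Rightarrow>\<^sub>C 'b" 1]
    by (simp add: apply_bcontfun_simps)
  have scale: "norm (c *\<^sub>C f) \<le> cmod c * norm f" for c and f :: "'a \<Rightarrow>\<^sub>C 'b"
    by (rule norm_bound) (auto simp: apply_bcontfun_simps norm_scaleC intro!: mult_left_mono norm_bounded)
  show "norm (c *\<^sub>C f) = cmod c * norm f"
  proof (cases "c = 0")
    case True
    then show ?thesis
      using scale[of c f] by simp
  next
    case False
    have "inverse c *\<^sub>C c *\<^sub>C f = f"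
      using False by (intro bcontfun_eqI) (simp add: apply_bcontfun_simps scaleC_scaleC scaleC_one)
    then have "norm f \<le> cmod (inverse c) * norm (c *\<^sub>C f)"
      using scale[of "inverse c" "c *\<^sub>C f"] by simp
    then have "cmod c * norm f \<le> norm (c *\<^sub>C f)"
      using False by (simp add: norm_divide norm_inverse field_simps)
    then show ?thesis
      using scale[of c f] by simp
  qed
  have "norm (f x) \<le> sqrt (norm (star f * f))" for x
    using norm_bounded[of "star f * f" x]
    by (simp add: apply_bcontfun_simps cstar_identity real_le_rsqrt)
  then have "norm f \<le> sqrt (norm (star f * f))"
    by (rule norm_bound)
  then have "(norm f)\<^sup>2 \<le> norm (star f * f)"
    by (metis norm_ge_zero power_mono real_sqrt_pow2)
  moreover have "norm (star f * f) \<le> (norm f)\<^sup>2"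
    by (rule norm_bound)
      (auto simp: apply_bcontfun_simps cstar_identity intro!: power_mono norm_bounded)
  ultimately show "norm (star f * f) = (norm f)\<^sup>2"
    by simp
qed

end

text \<open>Since SU(2) is compact, every continuous function on it is bounded.\<close>

lemma compact_SU2: "compact (UNIV :: su2 set)"
proof -
  define g :: "complex \<times> complex \<Rightarrow> complex^2^2" where
    "g = (\<lambda>(a, b). \<chi> i j. if i = 1 then if j = 1 then a else - cnj b
                            else if j = 1 then b else cnj a)"
  have g: "g (a, b) = vector [vector [a, - cnj b], vector [b, cnj a]]" for a b
    by (simp add: g_def vec_eq_iff forall_2)
  have "sphere 0 1 = {(a, b). (cmod a)\<^sup>2 + (cmod b)\<^sup>2 = 1}"
    by (auto simp: norm_Pair)
  then have SU2_image: "SU2 = g ` sphere 0 1"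
    unfolding SU2_eq by (force simp flip: g simp: image_iff)
  have "continuous_on (sphere 0 1) g"
    unfolding g_def case_prod_beta
  proof (intro continuous_on_vec_lambda)
    fix i j :: 2
    show "continuous_on (sphere 0 1) (\<lambda>x :: complex \<times> complex.
        if i = 1 then if j = 1 then fst x else - cnj (snd x)
        else if j = 1 then snd x else cnj (fst x))"
      by (cases "i = 1"; cases "j = 1"; simp; intro continuous_intros)
  qed
  then have "compact SU2"
    unfolding SU2_image by (rule compact_continuous_image) (rule compact_sphere)
  moreover have "continuous_on SU2 Abs_su2"
    by (auto simp: continuous_on_iff dist_su2_def Abs_su2_inverse)
  ultimately have "compact (Abs_su2 ` SU2)"
    by (rule compact_continuous_image[rotated])
  moreover have "Abs_su2 ` SU2 = UNIV"
    by (metis Abs_su2_cases UNIV_eq_I imageI)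
  ultimately show ?thesis
    by simp
qed

lemma continuous_imp_bcontfun:
  fixes f :: "su2 \<Rightarrow> complex"
  assumes "continuous_on UNIV f"
  shows "f \<in> bcontfun"
  using compact_continuous_image[OF assms compact_SU2] assms
  by (simp add: bcontfun_def compact_imp_bounded)

definition coord_alpha :: "su2 \<Rightarrow>\<^sub>C complex" where
  "coord_alpha = Bcontfun (\<lambda>M. Rep_su2 M $ 1 $ 1)"

definition coord_gamma :: "su2 \<Rightarrow>\<^sub>C complex" where
  "coord_gamma = Bcontfun (\<lambda>M. Rep_su2 M $ 2 $ 1)"

lemma apply_coord:
  "coord_alpha M = Rep_su2 M $ 1 $ 1" "coord_gamma M = Rep_su2 M $ 2 $ 1"
  by (simp_all add: coord_alpha_def coord_gamma_def Bcontfun_inverse continuous_imp_bcontfun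
      continuous_on_Rep_su2 continuous_intros)

lemma coord_sphere: "star coord_alpha * coord_alpha + star coord_gamma * coord_gamma = 1"
proof (rule bcontfun_eqI)
  fix M
  obtain a b where ab: "Rep_su2 M = vector [vector [a, - cnj b], vector [b, cnj a]]"
    "(cmod a)\<^sup>2 + (cmod b)\<^sup>2 = 1"
    using Rep_su2[of M] unfolding SU2_eq by blast
  have "cnj a * a + cnj b * b = complex_of_real ((cmod a)\<^sup>2 + (cmod b)\<^sup>2)"
    unfolding of_real_add complex_norm_square by (simp add: mult.commute)
  then show "(star coord_alpha * coord_alpha + star coord_gamma * coord_gamma) M =
      (1 :: su2 \<Rightarrow>\<^sub>C complex) M"
    by (simp add: apply_bcontfun_simps apply_coord star_complex_def ab)
qed


section \<open>Coercive maps and the Euler-Lagrange equations\<close>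

definition coercive :: "'a::cstar_algebra \<Rightarrow> 'a \<Rightarrow> ((su2 \<Rightarrow>\<^sub>C complex) \<Rightarrow> 'a) \<Rightarrow> bool" where
  "coercive U V \<phi> \<longleftrightarrow> star_hom \<phi> \<and>
     (\<exists>\<mu> \<nu> u v. \<mu> \<noteq> 0 \<and> \<nu> \<noteq> 0 \<and> unitary u \<and> unitary v \<and> u \<in> smooth U V \<and> v \<in> smooth U V \<and>
        \<phi> coord_alpha = \<mu> *\<^sub>C u \<and> \<phi> coord_gamma = \<nu> *\<^sub>C v)"

definition euler_lagrange_solution ::
    "'a::cstar_algebra \<Rightarrow> 'a \<Rightarrow> ('a \<Rightarrow> complex) \<Rightarrow> (nat \<Rightarrow> 'a \<Rightarrow> 'a) \<Rightarrow>
      ((su2 \<Rightarrow>\<^sub>C complex) \<Rightarrow> 'a) \<Rightarrow> bool" where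
  "euler_lagrange_solution U V \<tau> \<delta> \<phi> \<longleftrightarrow> coercive U V \<phi> \<and>
     (let \<alpha> = coord_alpha; \<gamma> = coord_gamma in
      \<forall>A B. self_adjoint A \<and> self_adjoint B \<and>
        \<phi> \<alpha> * A * \<phi> \<gamma> - \<phi> \<gamma> * \<phi> \<alpha> * A = \<phi> \<gamma> * B * \<phi> \<alpha> - \<phi> \<alpha> * \<phi> \<gamma> * B \<and>
        \<phi> \<alpha> * A * \<phi> (star \<gamma>) - \<phi> (star \<gamma>) * \<phi> \<alpha> * A =
          \<phi> \<alpha> * B * \<phi> (star \<gamma>) - B * \<phi> (star \<gamma>) * \<phi> \<alpha> \<longrightarrow>
        (\<Sum>j=1..2. \<tau> (A * \<delta> j (star (\<phi> \<alpha>) * \<delta> j (\<phi> \<alpha>)))) +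
        (\<Sum>j=1..2. \<tau> (B * \<delta> j (star (\<phi> \<gamma>) * \<delta> j (\<phi> \<gamma>)))) = 0)"

end

theory Submission
  imports Defs
begin

text \<open>
  Conjugation by a unimodular multiple \<open>w\<close> of a monomial \<open>U\<^sup>m V\<^sup>n\<close> acts diagonally on the monomials:
  since \<open>U\<close> and \<open>V\<close> commute up to a phase, so do any two monomials, and hence \<open>Ad w\<close> multiplies each
  monomial by a phase. The canonical derivations are diagonal in the monomials too. Therefore
  \<open>Ad w\<close> preserves the smooth elements and commutes there with \<open>\<delta>\<^sub>1\<close> and \<open>\<delta>\<^sub>2\<close>
  (lemmas \<open>smooth_Ad\<close> and \<open>derivation_Ad\<close>). Being an inner *-automorphism, it also preserves the trace
  (\<open>trace_Ad\<close>), self-adjointness and algebraic identities.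

  So a pair \<open>(A, B)\<close> is admissible in the Euler-Lagrange equations of \<open>Ad w \<circ> \<phi>\<close> exactly if
  \<open>(Ad w\<^sup>* A, Ad w\<^sup>* B)\<close> is admissible in those of \<open>\<phi>\<close>, and the expressions that have to vanish
  are the same for both.

  The second derivative in these expressions is applied to the product
  \<open>\<phi>(\<alpha>)\<^sup>* \<delta>\<^sub>j(\<phi>(\<alpha>))\<close>. To commute \<open>Ad w\<close> past it one has to know that this product is smooth, that
  is, that the smooth elements form a *-algebra. Closure under products (\<open>smooth_mult\<close>) is the analytic
  part: the coefficients of a product are a twisted convolution of rapidly decreasing families,
  and this is again rapidly decreasing.
\<close>

section \<open>Equality up to a phase\<close>

text \<open>
  The exact phases produced by reordering products of powers of \<open>U\<close> and \<open>V\<close> are irrelevant; only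
  their modulus matters. Reasoning with this congruence avoids computing them.
\<close>

definition phase_eq :: "'a::cstar_algebra \<Rightarrow> 'a \<Rightarrow> bool" (infix "\<doteq>" 50) where
  "x \<doteq> y \<longleftrightarrow> (\<exists>c. cmod c = 1 \<and> x = c *\<^sub>C y)"

lemma phase_eqI: "cmod c = 1 \<Longrightarrow> x = c *\<^sub>C y \<Longrightarrow> x \<doteq> y"
  by (auto simp: phase_eq_def)

lemma phase_eq_refl [simp]: "x \<doteq> x"
  by (rule phase_eqI[of 1]) (simp_all add: scaleC_one)

lemma cnj_mult_phase: "cmod c = 1 \<Longrightarrow> cnj c * c = 1"
  using complex_norm_square[of c] by (simp add: mult.commute)

lemma phase_eq_sym:
  assumes "x \<doteq> y"
  shows "y \<doteq> x"
proof -
  obtain c where "cmod c = 1" "x = c *\<^sub>C y"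
    using assms by (auto simp: phase_eq_def)
  then have "cmod (cnj c) = 1" "y = cnj c *\<^sub>C x"
    by (simp_all add: scaleC_scaleC cnj_mult_phase scaleC_one)
  then show ?thesis
    by (rule phase_eqI)
qed

lemma phase_eq_trans [trans]:
  assumes "x \<doteq> y" "y \<doteq> z"
  shows "x \<doteq> z"
proof -
  obtain c d where "cmod c = 1" "x = c *\<^sub>C y" "cmod d = 1" "y = d *\<^sub>C z"
    using assms by (auto simp: phase_eq_def)
  then show ?thesis
    by (intro phase_eqI[of "c * d"]) (simp_all add: norm_mult scaleC_scaleC)
qed

lemma phase_eq_mult:
  assumes "x \<doteq> y" "x' \<doteq> y'"
  shows "x * x' \<doteq> y * y'"
proof -
  obtain c d where "cmod c = 1" "x = c *\<^sub>C y" "cmod d = 1" "x' = d *\<^sub>C y'"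
    using assms by (auto simp: phase_eq_def)
  then show ?thesis
    by (intro phase_eqI[of "c * d"])
      (simp_all add: norm_mult scaleC_scaleC mult_scaleC_left mult_scaleC_right mult.commute)
qed

lemma phase_eq_star: "x \<doteq> y \<Longrightarrow> star x \<doteq> star y"
  unfolding phase_eq_def by (metis complex_mod_cnj star_scaleC)

section \<open>Unitaries and the conjugations they induce\<close>

lemma star_one [simp]: "star (1::'a::cstar_algebra) = 1"
  using star_mult[of "star 1" "1::'a"] by (simp add: star_star)

lemma star_power: "star (x ^ k) = star x ^ k"
  by (induction k) (simp_all add: star_mult flip: power_Suc2)

lemma unitary_cancel:
  assumes "unitary u"
  shows "star u * u = 1" "u * star u = 1" "star u * (u * x) = x" "u * (star u * x) = x"
  using assms by (simp_all add: unitary_def flip: mult.assoc)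

lemma unitary_mult:
  assumes "unitary u" "unitary v"
  shows "unitary (u * v)"
  unfolding unitary_def by (simp add: star_mult mult.assoc unitary_cancel assms)

lemma unitary_star: "unitary u \<Longrightarrow> unitary (star u)"
  by (simp add: unitary_def star_star)

lemma unitary_scaleC: "cmod c = 1 \<Longrightarrow> unitary u \<Longrightarrow> unitary (c *\<^sub>C u)"
  by (simp add: unitary_def star_scaleC mult_scaleC_left mult_scaleC_right scaleC_scaleC
      cnj_mult_phase scaleC_one mult.commute[of c])

lemma unitary_power: "unitary u \<Longrightarrow> unitary (u ^ k)"
  by (induction k) (simp add: unitary_def, simp add: unitary_mult)

lemma unitary_upow: "unitary u \<Longrightarrow> unitary (upow u k)"
  by (simp add: upow_def unitary_power unitary_star)

lemma norm_unitary: "unitary u \<Longrightarrow> norm (u::'a::cstar_algebra) = 1"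
  using cstar_identity[of u] norm_ge_zero[of u]
  by (auto simp: unitary_def power2_eq_1_iff simp del: norm_ge_zero)

lemma star_upow: "star (upow u k) = upow u (- k)"
  by (auto simp: upow_def star_power star_star)

lemma upow_Suc:
  assumes "unitary u"
  shows "upow u (k + 1) = u * upow u k"
proof (cases "0 \<le> k")
  case True
  then show ?thesis
    by (simp add: upow_def nat_add_distrib)
next
  case False
  define j where "j = nat (- k - 1)"
  with False have k: "k = - int (Suc j)"
    by simp
  have "upow u (- int j) = star u ^ j" for j
    by (auto simp: upow_def)
  from this[of j] this[of "Suc j"] show ?thesis
    using assms by (simp add: k unitary_cancel)
qed

lemma upow_pred: "unitary u \<Longrightarrow> upow u (k - 1) = star u * upow u k"
  using upow_Suc[of u "k - 1"] by (simp add: unitary_cancel)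

lemma upow_add:
  assumes "unitary u"
  shows "upow u (j + k) = upow u j * upow u k"
proof (induction j rule: int_induct[where k = 0])
  case base
  then show ?case by (simp add: upow_def)
next
  case (step1 i)
  have "upow u (i + 1 + k) = upow u (i + k + 1)"
    by (simp add: add_ac)
  then show ?case
    by (simp add: upow_Suc[OF assms] step1 mult.assoc)
next
  case (step2 i)
  have "upow u (i - 1 + k) = upow u (i + k - 1)"
    by (simp add: algebra_simps)
  then show ?case
    by (simp add: upow_pred[OF assms] step2 mult.assoc)
qed

text \<open>
  By induction on the exponent in both directions; the downward step uses that multiplying
  \<open>u x = c x u\<close> by \<open>u\<^sup>*\<close> on both sides gives the same kind of relation for \<open>u\<^sup>*\<close>.
\<close>

lemma upow_phase_commute:
  assumes u: "unitary u" and ux: "u * x \<doteq> x * u"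
  shows "upow u k * x \<doteq> x * upow u k"
proof (induction k rule: int_induct[where k = 0])
  case base
  then show ?case by (simp add: upow_def)
next
  case (step1 i)
  have "upow u (i + 1) * x = u * (upow u i * x)"
    by (simp add: upow_Suc[OF u] mult.assoc)
  also have "\<dots> \<doteq> u * (x * upow u i)"
    using step1 by (simp add: phase_eq_mult)
  also have "\<dots> = (u * x) * upow u i"
    by (simp add: mult.assoc)
  also have "\<dots> \<doteq> (x * u) * upow u i"
    using ux by (simp add: phase_eq_mult)
  also have "\<dots> = x * upow u (i + 1)"
    by (simp add: upow_Suc[OF u] mult.assoc)
  finally show ?case .
next
  case (step2 i)
  have "star u * (u * x) * star u \<doteq> star u * (x * u) * star u"
    using ux by (simp add: phase_eq_mult)
  then have "star u * x \<doteq> x * star u"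
    using u by (simp add: mult.assoc unitary_cancel phase_eq_sym)
  then have *: "star u * x * upow u i \<doteq> x * star u * upow u i"
    by (simp add: phase_eq_mult)
  have "upow u (i - 1) * x = star u * (upow u i * x)"
    by (simp add: upow_pred[OF u] mult.assoc)
  also have "\<dots> \<doteq> star u * (x * upow u i)"
    using step2 by (simp add: phase_eq_mult)
  also have "\<dots> \<doteq> x * upow u (i - 1)"
    using * by (simp add: upow_pred[OF u] mult.assoc)
  finally show ?case .
qed

lemma Ad_add: "Ad w (x + y) = Ad w x + Ad w y"
  and Ad_diff: "Ad w (x - y) = Ad w x - Ad w y"
  and Ad_scaleC: "Ad w (c *\<^sub>C x) = c *\<^sub>C Ad w x"
  and Ad_star: "Ad w (star x) = star (Ad w x)"
  by (simp_all add: Ad_def distrib_left distrib_right left_diff_distrib right_diff_distrib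
      mult_scaleC_left mult_scaleC_right star_mult star_star mult.assoc)

lemma Ad_mult: "unitary w \<Longrightarrow> Ad w (x * y) = Ad w x * Ad w y"
  and Ad_one: "unitary w \<Longrightarrow> Ad w 1 = 1"
  and Ad_inverse: "unitary w \<Longrightarrow> Ad w (Ad (star w) x) = x"
    "unitary w \<Longrightarrow> Ad (star w) (Ad w x) = x"
  by (simp_all add: Ad_def mult.assoc unitary_cancel star_star)

lemma Ad_eq_iff: "unitary w \<Longrightarrow> Ad w x = Ad w y \<longleftrightarrow> x = y"
  by (metis Ad_inverse(2))

lemma star_hom_Ad: "unitary w \<Longrightarrow> star_hom (Ad w)"
  by (simp add: star_hom_def Ad_add Ad_scaleC Ad_mult Ad_star Ad_one)

lemma star_hom_comp: "star_hom g \<Longrightarrow> star_hom f \<Longrightarrow> star_hom (g \<circ> f)"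
  by (simp add: star_hom_def)

lemma unitary_star_hom: 
  assumes f: "star_hom f" and u: "unitary u"
  shows "unitary (f u)"
proof -
  have mult: "f (x * y) = f x * f y" and star: "f (star x) = star (f x)" and one: "f 1 = 1" for x y
    using f by (simp_all add: star_hom_def)
  show ?thesis
    using u by (simp add: unitary_def one flip: mult star)
qed

lemma bounded_linear_Ad: "bounded_linear (Ad w)"
  unfolding Ad_def
  by (intro bounded_linear_intros)

section \<open>Rapidly decreasing double sequences\<close>

text \<open>
  This weight is submultiplicative, so its powers can be distributed over the two factors of a
  convolution.
\<close>

definition weight :: "int \<times> int \<Rightarrow> real" where
  "weight p = 1 + \<bar>real_of_int (fst p)\<bar> + \<bar>real_of_int (snd p)\<bar>"

lemma weight_ge_1: "1 \<le> weight p"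
  by (simp add: weight_def)

lemma weight_uminus: "weight (- p) = weight p"
  by (simp add: weight_def)

lemma weight_add: "weight (p + q) \<le> weight p * weight q"
proof -
  have "weight (p + q) \<le> weight p + weight q - 1"
    by (simp add: weight_def)
  also have "\<dots> \<le> weight p * weight q"
    using mult_nonneg_nonneg[of "weight p - 1" "weight q - 1"] weight_ge_1[of p] weight_ge_1[of q]
    by (simp add: algebra_simps)
  finally show ?thesis .
qed

lemma rapidly_decreasing_iff:
  "rapidly_decreasing a \<longleftrightarrow> (\<forall>k. \<exists>C. \<forall>p. weight p ^ k * cmod (a p) \<le> C)"
  by (simp add: rapidly_decreasing_def weight_def)

lemma rapidly_decreasing_norm_le:
  assumes a: "rapidly_decreasing a" and le: "\<And>p. cmod (b p) \<le> K * cmod (a p)"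
  shows "rapidly_decreasing b"
  unfolding rapidly_decreasing_iff
proof
  fix k
  obtain C where C: "weight p ^ k * cmod (a p) \<le> C" for p
    using a unfolding rapidly_decreasing_iff by blast
  have "weight p ^ k * cmod (b p) \<le> \<bar>K\<bar> * C" for p
  proof -
    have "cmod (b p) \<le> \<bar>K\<bar> * cmod (a p)"
      using le[of p] by (rule order_trans) (simp add: mult_right_mono)
    then have "weight p ^ k * cmod (b p) \<le> weight p ^ k * (\<bar>K\<bar> * cmod (a p))"
      using weight_ge_1[of p] by (intro mult_left_mono) auto
    also have "\<dots> = \<bar>K\<bar> * (weight p ^ k * cmod (a p))"
      by simp
    also have "\<dots> \<le> \<bar>K\<bar> * C"
      using C[of p] by (intro mult_left_mono) auto
    finally show ?thesis .
  qed
  then show "\<exists>C. \<forall>p. weight p ^ k * cmod (b p) \<le> C"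
    by blast
qed

lemma rapidly_decreasing_uminus:
  assumes "rapidly_decreasing a"
  shows "rapidly_decreasing (\<lambda>p. a (- p))"
  unfolding rapidly_decreasing_iff
proof
  fix k
  obtain C where C: "weight p ^ k * cmod (a p) \<le> C" for p
    using assms unfolding rapidly_decreasing_iff by blast
  have "weight p ^ k * cmod (a (- p)) \<le> C" for p
    using C[of "- p"] by (simp add: weight_uminus)
  then show "\<exists>C. \<forall>p. weight p ^ k * cmod (a (- p)) \<le> C"
    by blast
qed

lemma summable_on_int_inverse_square: "(\<lambda>m. 1 / (1 + \<bar>real_of_int m\<bar>)\<^sup>2) summable_on UNIV"
proof -
  define f where "f = (\<lambda>m. 1 / (1 + \<bar>real_of_int m\<bar>)\<^sup>2)"
  have "(\<lambda>n. f (int n)) summable_on UNIV"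
  proof (rule norm_summable_imp_summable_on)
    have "summable (\<lambda>n. inverse (real (Suc n) ^ 2))"
      using inverse_power_summable[of 2, where 'a = real] by (subst summable_Suc_iff) simp
    then show "summable (\<lambda>n. norm (f (int n)))"
      by (simp add: f_def inverse_eq_divide add.commute)
  qed
  moreover have "(\<lambda>n. f (- int n)) = (\<lambda>n. f (int n))"
    by (simp add: f_def)
  ultimately have "f summable_on range int" "f summable_on range (\<lambda>n. - int n)"
    by (simp_all add: summable_on_reindex inj_def o_def)
  then have "f summable_on (range int \<union> range (\<lambda>n. - int n))"
    by (rule summable_on_union)
  moreover have "range int \<union> range (\<lambda>n. - int n) = UNIV"
  proof (rule UNIV_eq_I[symmetric])
    fix m :: int
    show "m \<in> range int \<union> range (\<lambda>n. - int n)"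
      by (cases m rule: int_cases2) auto
  qed
  ultimately show ?thesis
    by (simp add: f_def)
qed

lemma summable_on_Times_nonneg:
  fixes f :: "'a \<Rightarrow> real" and g :: "'b \<Rightarrow> real"
  assumes f: "f summable_on A" and g: "g summable_on B"
    and "\<And>x. 0 \<le> f x" "\<And>y. 0 \<le> g y"
  shows "(\<lambda>(x, y). f x * g y) summable_on A \<times> B"
proof (rule summable_on_SigmaI)
  show "((\<lambda>y. case (x, y) of (x, y) \<Rightarrow> f x * g y) has_sum f x * infsum g B) B" for x
    using has_sum_cmult_right[OF has_sum_infsum[OF g]] by simp
  show "(\<lambda>x. f x * infsum g B) summable_on A"
    by (intro summable_on_cmult_left f)
qed (use assms in simp)

text \<open>
  The fourth power dominates the product \<open>(1 + \<bar>m\<bar>)\<^sup>2 (1 + \<bar>n\<bar>)\<^sup>2\<close>, which separates the variables.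
\<close>

lemma summable_on_weight: "(\<lambda>p. 1 / weight p ^ 4) summable_on UNIV"
proof -
  define f where "f = (\<lambda>m. 1 / (1 + \<bar>real_of_int m\<bar>)\<^sup>2)"
  have f: "f summable_on UNIV"
    using summable_on_int_inverse_square by (simp add: f_def)
  have "(\<lambda>(m, n). f m * f n) summable_on UNIV \<times> UNIV"
    by (intro summable_on_Times_nonneg f) (simp_all add: f_def)
  then have "(\<lambda>p. f (fst p) * f (snd p)) summable_on UNIV"
    by (simp add: case_prod_unfold)
  then show ?thesis
  proof (rule summable_on_comparison_test)
    fix p
    let ?x = "\<bar>real_of_int (fst p)\<bar>" and ?y = "\<bar>real_of_int (snd p)\<bar>"
    have "(1 + ?x)\<^sup>2 * (1 + ?y)\<^sup>2 \<le> weight p ^ 2 * weight p ^ 2"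
      by (intro mult_mono power_mono) (auto simp: weight_def)
    then show "1 / weight p ^ 4 \<le> f (fst p) * f (snd p)"
      using weight_ge_1[of p]
      by (auto simp: f_def simp flip: power_add intro!: divide_left_mono mult_pos_pos)
  qed (use weight_ge_1 in \<open>auto simp: order_trans[OF zero_le_one]\<close>)
qed

text \<open>
  Boundedness with four additional powers of the weight gives summability.
\<close>

lemma rapidly_decreasing_summable:
  assumes "rapidly_decreasing a"
  shows "(\<lambda>p. weight p ^ k * cmod (a p)) summable_on UNIV"
proof -
  obtain C where C: "weight p ^ (k + 4) * cmod (a p) \<le> C" for p
    using assms unfolding rapidly_decreasing_iff by blast
  have "(\<lambda>p. C * (1 / weight p ^ 4)) summable_on UNIV"
    by (intro summable_on_cmult_right summable_on_weight)
  then show ?thesis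
  proof (rule summable_on_comparison_test)
    fix p
    have "0 < weight p"
      using weight_ge_1[of p] by simp
    then show "weight p ^ k * cmod (a p) \<le> C * (1 / weight p ^ 4)" "0 \<le> weight p ^ k * cmod (a p)"
      using C[of p] by (simp_all add: power_add field_simps)
  qed
qed

lemma rapidly_decreasing_abs_summable:
  "rapidly_decreasing a \<Longrightarrow> (\<lambda>p. cmod (a p)) summable_on UNIV"
  using rapidly_decreasing_summable[of a 0] by simp

text \<open>
  Up to phases \<open>\<sigma>\<close>, this is how coefficients of smooth elements multiply. Moving the weight
  \<open>weight r ^ k\<close> inside and splitting it over \<open>p\<close> and \<open>r - p\<close> bounds the summand by
  a constant, which comes from \<open>b\<close>, times the summable family \<open>weight p ^ k * cmod (a p)\<close>; the bound
  is uniform in \<open>r\<close>.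
\<close>

lemma rapidly_decreasing_convolution:
  assumes a: "rapidly_decreasing a" and b: "rapidly_decreasing b"
    and \<sigma>: "\<And>p q. cmod (\<sigma> p q) = 1"
  shows "rapidly_decreasing (\<lambda>r. \<Sum>\<^sub>\<infinity>p. a p * b (r - p) * \<sigma> p (r - p))"
    and "(\<lambda>p. cmod (a p * b (r - p) * \<sigma> p (r - p))) summable_on UNIV"
proof -
  \<comment> \<open>The constant depends on \<open>k\<close> but not on \<open>r\<close>.\<close>
  have le: "\<exists>C. \<forall>r p. weight r ^ k * cmod (a p * b (r - p) * \<sigma> p (r - p))
      \<le> C * (weight p ^ k * cmod (a p))" for k
  proof -
    obtain C where C: "weight p ^ k * cmod (b p) \<le> C" for p
      using b unfolding rapidly_decreasing_iff by blast
    have "weight r ^ k * cmod (a p * b (r - p) * \<sigma> p (r - p))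
      \<le> C * (weight p ^ k * cmod (a p))" for r p
    proof -
      have "weight r ^ k \<le> (weight p * weight (r - p)) ^ k"
        using weight_add[of p "r - p"] weight_ge_1[of r] by (intro power_mono) auto
      then have "weight r ^ k * cmod (a p * b (r - p) * \<sigma> p (r - p))
          \<le> (weight p * weight (r - p)) ^ k * (cmod (a p) * cmod (b (r - p)))"
        by (simp add: norm_mult \<sigma> mult_right_mono)
      also have "\<dots> = (weight (r - p) ^ k * cmod (b (r - p))) * (weight p ^ k * cmod (a p))"
        by (simp add: power_mult_distrib mult_ac)
      also have "\<dots> \<le> C * (weight p ^ k * cmod (a p))"
        using C[of "r - p"] weight_ge_1[of p] by (intro mult_right_mono) auto
      finally show ?thesis .
    qed
    then show ?thesis
      by blast
  qed
  have s: "(\<lambda>p. weight r ^ k * cmod (a p * b (r - p) * \<sigma> p (r - p))) summable_on UNIV" for r k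
  proof -
    obtain C where "weight r ^ k * cmod (a p * b (r - p) * \<sigma> p (r - p))
      \<le> C * (weight p ^ k * cmod (a p))" for p
      using le[of k] by blast
    then show ?thesis
      using weight_ge_1[of r]
      by (intro summable_on_comparison_test[OF
            summable_on_cmult_right[OF rapidly_decreasing_summable[OF a]]]) auto
  qed
  from s[where k=0] show *: "(\<lambda>p. cmod (a p * b (r - p) * \<sigma> p (r - p))) summable_on UNIV" for r
    by simp
  show "rapidly_decreasing (\<lambda>r. \<Sum>\<^sub>\<infinity>p. a p * b (r - p) * \<sigma> p (r - p))"
    unfolding rapidly_decreasing_iff
  proof
    fix k
    obtain C where C: "weight r ^ k * cmod (a p * b (r - p) * \<sigma> p (r - p))
      \<le> C * (weight p ^ k * cmod (a p))" for r p
      using le[of k] by blast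
    have "weight r ^ k * cmod (\<Sum>\<^sub>\<infinity>p. a p * b (r - p) * \<sigma> p (r - p))
        \<le> (\<Sum>\<^sub>\<infinity>p. C * (weight p ^ k * cmod (a p)))" for r
    proof -
      have "weight r ^ k * cmod (\<Sum>\<^sub>\<infinity>p. a p * b (r - p) * \<sigma> p (r - p))
          \<le> weight r ^ k * (\<Sum>\<^sub>\<infinity>p. cmod (a p * b (r - p) * \<sigma> p (r - p)))"
        using weight_ge_1[of r] by (intro mult_left_mono norm_infsum_bound *) auto
      also have "\<dots> = (\<Sum>\<^sub>\<infinity>p. weight r ^ k * cmod (a p * b (r - p) * \<sigma> p (r - p)))"
        by (rule infsum_cmult_right[symmetric]) (rule *)
      also have "\<dots> \<le> (\<Sum>\<^sub>\<infinity>p. C * (weight p ^ k * cmod (a p)))"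
        by (intro infsum_mono s C summable_on_cmult_right rapidly_decreasing_summable a)
      finally show ?thesis .
    qed
    then show "\<exists>C. \<forall>r. weight r ^ k * cmod (\<Sum>\<^sub>\<infinity>p. a p * b (r - p) * \<sigma> p (r - p)) \<le> C"
      by blast
  qed
qed

section \<open>The smooth subalgebra\<close>

lemma smoothI:
  "rapidly_decreasing a \<Longrightarrow> ((\<lambda>p. a p *\<^sub>C monomial U V p) has_sum x) UNIV \<Longrightarrow> x \<in> smooth U V"
  unfolding smooth_def by blast

lemma smoothE:
  assumes "x \<in> smooth U V"
  obtains a where "rapidly_decreasing a" "((\<lambda>p. a p *\<^sub>C monomial U V p) has_sum x) UNIV"
  using assms unfolding smooth_def by blast

lemma smooth_scaleC:
  assumes "x \<in> smooth U V"
  shows "c *\<^sub>C x \<in> smooth U V"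
proof -
  obtain a where a: "rapidly_decreasing a" "((\<lambda>p. a p *\<^sub>C monomial U V p) has_sum x) UNIV"
    using assms by (rule smoothE)
  show ?thesis
  proof (rule smoothI)
    show "rapidly_decreasing (\<lambda>p. c * a p)"
      by (rule rapidly_decreasing_norm_le[OF a(1), of _ "cmod c"]) (simp add: norm_mult)
    show "((\<lambda>p. (c * a p) *\<^sub>C monomial U V p) has_sum c *\<^sub>C x) UNIV"
      using has_sum_bounded_linear[OF bounded_linear_scaleC a(2), of c]
      by (simp add: scaleC_scaleC)
  qed
qed

locale phase_commuting_unitaries =
  fixes U V :: "'a::cstar_algebra"
  assumes unitary_U: "unitary U" and unitary_V: "unitary V" and phase_commute: "U * V \<doteq> V * U"
begin

abbreviation W :: "int \<times> int \<Rightarrow> 'a" where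
  "W \<equiv> monomial U V"

lemma unitary_monomial: "unitary (W p)"
  by (simp add: monomial_def case_prod_beta unitary_mult unitary_upow unitary_U unitary_V)

lemma upow_commute: "upow V n * upow U m \<doteq> upow U m * upow V n"
proof -
  have "upow U m * V \<doteq> V * upow U m"
    by (rule upow_phase_commute[OF unitary_U phase_commute])
  then show ?thesis
    by (rule upow_phase_commute[OF unitary_V phase_eq_sym])
qed

lemma monomial_mult: "W p * W q \<doteq> W (p + q)"
proof -
  have "upow U (fst p) * (upow V (snd p) * upow U (fst q)) * upow V (snd q)
      \<doteq> upow U (fst p) * (upow U (fst q) * upow V (snd p)) * upow V (snd q)"
    by (intro phase_eq_mult upow_commute phase_eq_refl)
  then show ?thesis
    by (simp add: monomial_def case_prod_beta upow_add unitary_U unitary_V mult.assoc)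
qed

lemma monomial_star: "star (W p) \<doteq> W (- p)"
  using upow_commute by (simp add: monomial_def case_prod_beta star_mult star_upow)

lemma monomial_commute: "W p * W q \<doteq> W q * W p"
  using monomial_mult[of p q] monomial_mult[of q p]
  unfolding add.commute[of q p] by (rule phase_eq_trans[OF _ phase_eq_sym])

text \<open>
  Moving \<open>w\<close> past the monomial costs a phase, and then \<open>w\<close> cancels against its adjoint.
\<close>

lemma Ad_monomial:
  assumes "w \<doteq> W q"
  shows "Ad w (W p) \<doteq> W p"
proof -
  have "w * W p * star w \<doteq> W q * W p * star (W q)"
    using assms by (intro phase_eq_mult phase_eq_star phase_eq_refl)
  also have "\<dots> \<doteq> W p * W q * star (W q)"
    by (intro phase_eq_mult monomial_commute phase_eq_refl)
  also have "\<dots> = W p"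
    using unitary_monomial by (simp add: mult.assoc unitary_cancel)
  finally show ?thesis
    by (simp add: Ad_def)
qed

lemma smooth_star:
  assumes "x \<in> smooth U V"
  shows "star x \<in> smooth U V"
proof -
  obtain a where a: "rapidly_decreasing a" "((\<lambda>p. a p *\<^sub>C W p) has_sum x) UNIV"
    using assms by (rule smoothE)
  obtain \<sigma> where \<sigma>: "cmod (\<sigma> p) = 1" "star (W p) = \<sigma> p *\<^sub>C W (- p)" for p
    using monomial_star unfolding phase_eq_def by metis
  show ?thesis
  proof (rule smoothI)
    show "rapidly_decreasing (\<lambda>p. cnj (a (- p)) * \<sigma> (- p))"
      by (rule rapidly_decreasing_norm_le[OF rapidly_decreasing_uminus[OF a(1)], of _ 1])
        (simp add: norm_mult \<sigma>)
    have "((\<lambda>p. (cnj (a p) * \<sigma> p) *\<^sub>C W (- p)) has_sum star x) UNIV"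
      using has_sum_bounded_linear[OF bounded_linear_star a(2)]
      by (simp add: star_scaleC \<sigma> scaleC_scaleC)
    then show "((\<lambda>p. (cnj (a (- p)) * \<sigma> (- p)) *\<^sub>C W p) has_sum star x) UNIV"
      by (rule has_sum_reindex_bij_witness[of _ uminus uminus, THEN iffD1, rotated -1]) auto
  qed
qed

text \<open>
  Multiplying the two expansions gives an absolutely convergent double series over \<open>(p, q)\<close>.
  Summed by \<open>r = p + q\<close> it becomes an expansion of the product, with convolved coefficients.
\<close>

lemma smooth_mult:
  assumes "x \<in> smooth U V" "y \<in> smooth U V"
  shows "x * y \<in> smooth U V"
proof -
  obtain a where a: "rapidly_decreasing a" "((\<lambda>p. a p *\<^sub>C W p) has_sum x) UNIV"
    using assms(1) by (rule smoothE)
  obtain b where b: "rapidly_decreasing b" "((\<lambda>p. b p *\<^sub>C W p) has_sum y) UNIV"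
    using assms(2) by (rule smoothE)
  obtain \<sigma> where \<sigma>: "cmod (\<sigma> p q) = 1" "W p * W q = \<sigma> p q *\<^sub>C W (p + q)" for p q
    using monomial_mult unfolding phase_eq_def by metis
  define F where "F = (\<lambda>(p, q). (a p * b q) *\<^sub>C (W p * W q))"
  define c where "c = (\<lambda>r p. a p * b (r - p) * \<sigma> p (r - p))"
  have "(\<lambda>z. cmod (case z of (p, q) \<Rightarrow> a p * b q)) summable_on UNIV \<times> UNIV"
    using summable_on_Times_nonneg[OF rapidly_decreasing_abs_summable[OF a(1)]
        rapidly_decreasing_abs_summable[OF b(1)]]
    by (simp add: case_prod_unfold norm_mult)
  then have "F abs_summable_on UNIV \<times> UNIV"
    by (simp add: F_def case_prod_beta norm_scaleC norm_unitary unitary_mult unitary_monomial)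
  then have "F summable_on UNIV \<times> UNIV"
    by (rule abs_summable_summable)
  moreover have "((\<lambda>q. F (p, q)) has_sum (a p *\<^sub>C W p) * y) UNIV" for p
    using has_sum_bounded_linear[OF bounded_linear_mult_right b(2), of "a p *\<^sub>C W p"]
    by (simp add: F_def mult_scaleC_left mult_scaleC_right scaleC_scaleC mult.commute)
  moreover have "((\<lambda>p. (a p *\<^sub>C W p) * y) has_sum x * y) UNIV"
    by (rule has_sum_bounded_linear[OF bounded_linear_mult_left a(2)])
  ultimately have "(F has_sum x * y) (UNIV \<times> UNIV)"
    by (intro has_sum_SigmaI)
  then have double_sum: "((\<lambda>(r, p). c r p *\<^sub>C W r) has_sum x * y) (UNIV \<times> UNIV)"
    by (rule has_sum_reindex_bij_witness[of _ "\<lambda>(r, p). (p, r - p)" "\<lambda>(p, q). (p + q, p)",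
          THEN iffD1, rotated -1])
      (auto simp: F_def c_def \<sigma> scaleC_scaleC)
  have inner_sum: "((\<lambda>p. c r p *\<^sub>C W r) has_sum infsum (c r) UNIV *\<^sub>C W r) UNIV" for r
  proof -
    have bl: "bounded_linear (\<lambda>c. c *\<^sub>C W r)"
      by (rule bounded_linear_intro[of _ 1])
        (simp_all add: scaleC_add_left scaleR_eq_scaleC scaleC_scaleC norm_scaleC
          norm_unitary unitary_monomial scaleC_complex_def)
    have "c r summable_on UNIV"
      using rapidly_decreasing_convolution(2)[OF a(1) b(1) \<sigma>(1)]
      unfolding c_def by (rule abs_summable_summable)
    then show ?thesis
      by (intro has_sum_bounded_linear[OF bl]) simp
  qed
  have "((\<lambda>r. infsum (c r) UNIV *\<^sub>C W r) has_sum x * y) UNIV"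
    by (rule has_sum_SigmaD[OF double_sum]) (simp add: inner_sum)
  moreover have "rapidly_decreasing (\<lambda>r. infsum (c r) UNIV)"
    unfolding c_def by (rule rapidly_decreasing_convolution(1)[OF a(1) b(1) \<sigma>(1)])
  ultimately show ?thesis
    by (intro smoothI)
qed

text \<open>
  Both the conjugation and the derivation multiply the coefficient of each monomial by a scalar,
  and scalars commute. A phase does not affect rapid decrease, so the derivation may be applied term
  by term before and after conjugating.
\<close>

lemma
  assumes w: "w \<doteq> W q" and x: "x \<in> smooth U V"
  shows smooth_Ad: "Ad w x \<in> smooth U V"
    and derivation_Ad: "smooth_star_derivation U V d \<Longrightarrow> (\<And>p. d (W p) = k p *\<^sub>C W p) \<Longrightarrow>
      d (Ad w x) = Ad w (d x)"
proof -
  obtain a where a: "rapidly_decreasing a" "((\<lambda>p. a p *\<^sub>C W p) has_sum x) UNIV"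
    using x by (rule smoothE)
  obtain \<kappa> where \<kappa>: "cmod (\<kappa> p) = 1" "Ad w (W p) = \<kappa> p *\<^sub>C W p" for p
    using Ad_monomial[OF w] unfolding phase_eq_def by metis
  have r: "rapidly_decreasing (\<lambda>p. a p * \<kappa> p)"
    by (rule rapidly_decreasing_norm_le[OF a(1), of _ 1]) (simp add: norm_mult \<kappa>)
  have s: "((\<lambda>p. (a p * \<kappa> p) *\<^sub>C W p) has_sum Ad w x) UNIV"
    using has_sum_bounded_linear[OF bounded_linear_Ad a(2), of w]
    by (simp add: Ad_scaleC \<kappa> scaleC_scaleC)
  from r s show "Ad w x \<in> smooth U V"
    by (rule smoothI)
  show "d (Ad w x) = Ad w (d x)" if d: "smooth_star_derivation U V d"
    and k: "\<And>p. d (W p) = k p *\<^sub>C W p"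
  proof -
    have termwise: "((\<lambda>p. f p *\<^sub>C d (W p)) has_sum d y) UNIV"
      if "rapidly_decreasing f" "((\<lambda>p. f p *\<^sub>C W p) has_sum y) UNIV" for f y
      using d that unfolding smooth_star_derivation_def by blast
    have "((\<lambda>p. (a p * \<kappa> p) *\<^sub>C d (W p)) has_sum Ad w (d x)) UNIV"
      using has_sum_bounded_linear[OF bounded_linear_Ad termwise[OF a], of w]
      by (simp add: Ad_scaleC k \<kappa> scaleC_scaleC mult_ac)
    with termwise[OF r s] show ?thesis
      by (rule has_sum_unique)
  qed
qed

end

section \<open>Invariance of the Euler-Lagrange equations\<close>

lemma rotation_algebra_phase_commuting:
  "rotation_algebra \<theta> U V \<Longrightarrow> phase_commuting_unitaries U V"
  unfolding rotation_algebra_def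
  by unfold_locales (auto intro: phase_eqI[rotated])

text \<open>
  The eigenvalues on \<open>U\<^sup>m V\<^sup>n\<close> are \<open>2\<pi>\<i>m\<close> for \<open>\<delta>\<^sub>1\<close> and \<open>2\<pi>\<i>n\<close> for \<open>\<delta>\<^sub>2\<close>.
\<close>

lemma canonical_derivation_monomial:
  assumes "canonical_derivations U V \<delta>" and j: "j \<in> {1..2}"
  shows "smooth_star_derivation U V (\<delta> j)" and "\<exists>k. \<forall>p. \<delta> j (monomial U V p) = k p *\<^sub>C monomial U V p"
proof -
  have d: "smooth_star_derivation U V (\<delta> 1)" "smooth_star_derivation U V (\<delta> 2)"
    and v: "\<delta> 1 U = (complex_of_real (2 * pi) * \<i>) *\<^sub>C U" "\<delta> 1 V = (complex_of_real 0 * \<i>) *\<^sub>C V"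
      "\<delta> 2 U = (complex_of_real 0 * \<i>) *\<^sub>C U" "\<delta> 2 V = (complex_of_real (2 * pi) * \<i>) *\<^sub>C V"
    using assms by (simp_all add: canonical_derivations_def scaleC_zero)
  have j12: "j = 1 \<or> j = 2"
    using j by auto
  with d show "smooth_star_derivation U V (\<delta> j)"
    by blast
  have "\<exists>k. \<delta> j (monomial U V p) = k *\<^sub>C monomial U V p" for p
    using j12 smooth_star_derivation_monomial[OF d(1) v(1,2), of "fst p" "snd p"]
      smooth_star_derivation_monomial[OF d(2) v(3,4), of "fst p" "snd p"] by auto
  then show "\<exists>k. \<forall>p. \<delta> j (monomial U V p) = k p *\<^sub>C monomial U V p"
    by metis
qed

lemma trace_Ad:
  assumes "canonical_trace U V \<tau>" "unitary w"
  shows "\<tau> (Ad w x) = \<tau> x"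
proof -
  have "\<tau> (w * (x * star w)) = \<tau> (x * star w * w)"
    using assms(1) unfolding canonical_trace_def by metis
  then show ?thesis
    using assms(2) by (simp add: Ad_def mult.assoc unitary_cancel)
qed

theorem theorem3p8:
  fixes \<theta> :: real and U V w :: "'a::cstar_algebra" and \<tau> :: "'a \<Rightarrow> complex"
    and \<delta> :: "nat \<Rightarrow> 'a \<Rightarrow> 'a" and \<phi> :: "(su2 \<Rightarrow>\<^sub>C complex) \<Rightarrow> 'a"
    and m n :: int and z :: complex
  assumes "\<theta> \<notin> \<rat>"
    and "rotation_algebra \<theta> U V"
    and "canonical_trace U V \<tau>"
    and "canonical_derivations U V \<delta>"
    and "cmod z = 1"
    and "w = z *\<^sub>C (upow U m * upow V n)"
    and "euler_lagrange_solution U V \<tau> \<delta> \<phi>"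
  shows "euler_lagrange_solution U V \<tau> \<delta> (Ad w \<circ> \<phi>)"
proof -
  interpret phase_commuting_unitaries U V
    using assms(2) by (rule rotation_algebra_phase_commuting)
  have w_eq: "w = z *\<^sub>C W (m, n)"
    using assms(6) by (simp add: monomial_def)
  then have w: "w \<doteq> W (m, n)" and uw: "unitary w"
    using assms(5) by (auto intro: phase_eqI unitary_scaleC unitary_monomial)
  have co: "coercive U V \<phi>"
    using assms(7) by (simp add: euler_lagrange_solution_def)
  then obtain \<mu> \<nu> u v where hom: "star_hom \<phi>" and nz: "\<mu> \<noteq> 0" "\<nu> \<noteq> 0"
    and uv: "unitary u" "unitary v" "u \<in> smooth U V" "v \<in> smooth U V"
    and \<phi>: "\<phi> coord_alpha = \<mu> *\<^sub>C u" "\<phi> coord_gamma = \<nu> *\<^sub>C v"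
    unfolding coercive_def by blast
  have co': "coercive U V (Ad w \<circ> \<phi>)"
    unfolding coercive_def
  proof (intro conjI exI)
    show "star_hom (Ad w \<circ> \<phi>)"
      by (intro star_hom_comp star_hom_Ad uw hom)
    show "unitary (Ad w u)" "unitary (Ad w v)"
      using uv by (auto intro: unitary_star_hom star_hom_Ad uw)
    show "Ad w u \<in> smooth U V" "Ad w v \<in> smooth U V"
      using uv by (auto intro: smooth_Ad[OF w])
    show "(Ad w \<circ> \<phi>) coord_alpha = \<mu> *\<^sub>C Ad w u" "(Ad w \<circ> \<phi>) coord_gamma = \<nu> *\<^sub>C Ad w v"
      by (simp_all add: \<phi> Ad_scaleC)
  qed (use nz in auto)
  \<comment> \<open>Each summand of the Euler-Lagrange expression is invariant under conjugating all its entries.\<close>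
  have trace_eq: "\<tau> (Ad w A * \<delta> j (star (Ad w x) * \<delta> j (Ad w x))) = \<tau> (A * \<delta> j (star x * \<delta> j x))"
    if j: "j \<in> {1..2}" and x: "x \<in> smooth U V" for A x j
  proof -
    obtain k where d: "smooth_star_derivation U V (\<delta> j)" and k: "\<And>p. \<delta> j (W p) = k p *\<^sub>C W p"
      using canonical_derivation_monomial[OF assms(4) j] by blast
    have "\<delta> j x \<in> smooth U V"
      using d x unfolding smooth_star_derivation_def by blast
    then have "star x * \<delta> j x \<in> smooth U V"
      using x by (intro smooth_mult smooth_star)
    then have "\<delta> j (Ad w (star x * \<delta> j x)) = Ad w (\<delta> j (star x * \<delta> j x))"
      by (rule derivation_Ad[OF w _ d k])
    moreover have "star (Ad w x) * \<delta> j (Ad w x) = Ad w (star x * \<delta> j x)"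
      using uw by (simp add: derivation_Ad[OF w x d k] Ad_mult Ad_star)
    ultimately have "Ad w A * \<delta> j (star (Ad w x) * \<delta> j (Ad w x)) = Ad w (A * \<delta> j (star x * \<delta> j x))"
      using uw by (simp add: Ad_mult)
    then show ?thesis
      using trace_Ad[OF assms(3) uw] by simp
  qed
  have sm: "\<phi> coord_alpha \<in> smooth U V" "\<phi> coord_gamma \<in> smooth U V"
    using uv by (simp_all add: \<phi> smooth_scaleC)
  show ?thesis
    unfolding euler_lagrange_solution_def Let_def
  proof (intro conjI allI impI co', elim conjE)
    fix A B :: 'a
    assume sa: "self_adjoint A" "self_adjoint B"
    let ?a = "\<phi> coord_alpha" and ?c = "\<phi> coord_gamma" and ?c' = "\<phi> (star coord_gamma)"
    \<comment> \<open>Pulling the test pair back by the inverse automorphism makes it a test pair for \<open>\<phi>\<close>.\<close>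
    define A' B' where AB': "A' = Ad (star w) A" "B' = Ad (star w) B"
    have AB: "A = Ad w A'" "B = Ad w B'"
      using uw by (simp_all add: AB' Ad_inverse)
    assume e1: "(Ad w \<circ> \<phi>) coord_alpha * A * (Ad w \<circ> \<phi>) coord_gamma
        - (Ad w \<circ> \<phi>) coord_gamma * (Ad w \<circ> \<phi>) coord_alpha * A
      = (Ad w \<circ> \<phi>) coord_gamma * B * (Ad w \<circ> \<phi>) coord_alpha
        - (Ad w \<circ> \<phi>) coord_alpha * (Ad w \<circ> \<phi>) coord_gamma * B"
      and e2: "(Ad w \<circ> \<phi>) coord_alpha * A * (Ad w \<circ> \<phi>) (star coord_gamma)
        - (Ad w \<circ> \<phi>) (star coord_gamma) * (Ad w \<circ> \<phi>) coord_alpha * A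
      = (Ad w \<circ> \<phi>) coord_alpha * B * (Ad w \<circ> \<phi>) (star coord_gamma)
        - B * (Ad w \<circ> \<phi>) (star coord_gamma) * (Ad w \<circ> \<phi>) coord_alpha"
    have "self_adjoint A'" "self_adjoint B'"
      using sa by (simp_all add: self_adjoint_def AB' flip: Ad_star)
    moreover have "?a * A' * ?c - ?c * ?a * A' = ?c * B' * ?a - ?a * ?c * B'"
      using e1 by (simp add: AB Ad_eq_iff[OF uw] flip: Ad_mult[OF uw] Ad_diff)
    moreover have "?a * A' * ?c' - ?c' * ?a * A' = ?a * B' * ?c' - B' * ?c' * ?a"
      using e2 by (simp add: AB Ad_eq_iff[OF uw] flip: Ad_mult[OF uw] Ad_diff)
    ultimately have "(\<Sum>j=1..2. \<tau> (A' * \<delta> j (star ?a * \<delta> j ?a)))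
        + (\<Sum>j=1..2. \<tau> (B' * \<delta> j (star ?c * \<delta> j ?c))) = 0"
      using assms(7) unfolding euler_lagrange_solution_def Let_def by blast
    moreover have "(\<Sum>j=1..2. \<tau> (A * \<delta> j (star (Ad w ?a) * \<delta> j (Ad w ?a))))
        = (\<Sum>j=1..2. \<tau> (A' * \<delta> j (star ?a * \<delta> j ?a)))"
      unfolding AB by (intro sum.cong refl trace_eq sm)
    moreover have "(\<Sum>j=1..2. \<tau> (B * \<delta> j (star (Ad w ?c) * \<delta> j (Ad w ?c))))
        = (\<Sum>j=1..2. \<tau> (B' * \<delta> j (star ?c * \<delta> j ?c)))"
      unfolding AB by (intro sum.cong refl trace_eq sm)
    ultimately show "(\<Sum>j=1..2. \<tau> (A * \<delta> j (star ((Ad w \<circ> \<phi>) coord_alpha) * \<delta> j ((Ad w \<circ> \<phi>) coord_alpha))))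
        + (\<Sum>j=1..2. \<tau> (B * \<delta> j (star ((Ad w \<circ> \<phi>) coord_gamma) * \<delta> j ((Ad w \<circ> \<phi>) coord_gamma)))) = 0"
      by simp
  qed
qed

end
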